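(* Let $\delta>0$ and let $q\ge 0$ be a supplier price with $q\notin\mathbb S_{cc,\delta}$ and $q\le \bar q_s$, where $$\bar q_s:=\frac{\bar d-\alpha(1-\varepsilon)C_M-2\sqrt{\alpha(1-\varepsilon)O_M}}{\alpha(1-\varepsilon)}.$$ Suppose $s_\delta(q)\le e_\delta(q)$, with $s_\delta(q), e_\delta(q)$ as defined in the context. If $l$ is a positive integer with $l\delta\in[s_\delta(q),e_\delta(q)]$, then $(l\delta,l\delta)$ is a (symmetric) pure strategy Nash equilibrium of the manufacturer game $\mathbb G(q,\delta)$.
   Context: Parameters: $\bar d>0$, $\alpha>0$, $0<\varepsilon<1$, $C_M\ge0$, $O_M>0$, $C_S\ge 0$ are real constants, with the standing assumption $\bar d>\alpha(C_S+C_M)+2\sqrt{\alpha O_M}$. For a supplier price $q\ge0$ put $C_{M_q}:=C_M+q$. For $x\in\mathbb R$, $x^+:=\max\{x,0\}$. Game $\mathbb G(q,\delta)$: two players (manufacturers) $i,j$, each with strategy set $\mathbb P_\delta\cup\{n_o\}$, where $\mathbb P_\delta=\{0,\delta,2\delta,\dots\}$ and $n_o$ means "do not operate". Define - $W_1(p,p')=(\bar d-\alpha(1-\varepsilon)p+\varepsilon\alpha p')^+(p-C_{M_q})-O_M$, - $W_2(p)=(\bar d-\alpha p)^+(p-C_{M_q})-O_M$, - $W_3(p)=(\bar d-\alpha(1-\varepsilon)p)^+(p-C_{M_q})-O_M$, - $W_4(p)=(\bar d(1+\varepsilon)-\alpha(1-\varepsilon)p)^+(p-C_{M_q})-O_M$.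 The utility of player $i$ is $U_i(p_i,p_j)=0$ if $p_i=n_o$; and, for $p_i\in\mathbb P_\delta$, it equals $W_4(p_i)$ if $p_j=n_o$, $W_1(p_i,p_j)$ if $p_i<p_j$, $W_2(p_i)$ if $p_i>p_j$, and $W_3(p_i)$ if $p_i=p_j$. The utility of player $j$ is defined symmetrically, with the roles of $i$ and $j$ exchanged. A pure strategy Nash equilibrium is a pair of strategies, each of which maximizes its player's utility over $\mathbb P_\delta\cup\{n_o\}$ given the other's strategy. Regimes: $W_{4,\delta}^*:=\max_{p\in\mathbb P_\delta}W_4(p)$, $W_{2,\delta}^*:=\max_{p\in\mathbb P_\delta}W_2(p)$ (both depend on $q$); $\mathbb S_{cc,\delta}:=\{q: W_{4,\delta}^*<0\}$, $\mathbb S_{dp,\delta}:=\{q: W_{2,\delta}^*\ge0\}$, $\mathbb S_{pc,\delta}:=\{q: W_{2,\delta}^*<0\}$. Coefficients: $\lambda_s=\bar d+\alpha(1-\varepsilon)C_{M_q}$, $\ \underline\lambda_s=\bar d-\alpha(1-\varepsilon)C_{M_q}$, $\ \varrho_s=-\bar d\,C_{M_q}-(W_{2,\delta}^* )^+-O_M$, $\lambda_e=\alpha\varepsilon C_{M_q}+\alpha\delta(3\varepsilon-2)$, $\ \varrho_e=\delta\alpha(1-\varepsilon)(C_{M_q}+\delta)+\bar d\,\delta$, $$s_\delta(q)=\frac{\lambda_s-\sqrt{\lambda_s^2+4\alpha(1-\varepsilon)\varrho_s}}{2\alpha(1-\varepsilon)},$$ $$\tilde e=\min\left\{\frac{\lambda_e+\sqrt{\lambda_e^2+4\alpha\varepsilon\varrho_e}}{2\alpha\varepsilon},\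 \frac{\lambda_s+\sqrt{\underline\lambda_s^2-4\alpha(1-\varepsilon)O_M}}{2\alpha(1-\varepsilon)}\right\},$$ $$e_\delta(q)=\begin{cases}\min\left\{\dfrac{\lambda_s+\sqrt{\lambda_s^2+4\alpha(1-\varepsilon)\varrho_s}}{2\alpha(1-\varepsilon)},\ \tilde e\right\}& \text{if } q\in\mathbb S_{dp,\delta},\\[2mm] \tilde e&\text{if } q\in\mathbb S_{pc,\delta}.\end{cases}$$ *)

theory Defs
  imports Complex_Main
begin

text \<open>The model's constants: \<open>d\<close>-bar, \<open>\<alpha>\<close>, \<open>\<epsilon>\<close>, and the costs \<open>C\<^sub>M\<close>, \<open>O\<^sub>M\<close>, \<open>C\<^sub>S\<close>; the last one enters only the
  standing assumption relating it to \<open>d\<close>-bar.\<close>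

record market =
  dbar :: real
  alpha :: real
  eps :: real
  CM :: real
  OM :: real
  CS :: real

definition CMq :: "market \<Rightarrow> real \<Rightarrow> real" where
  "CMq M q = CM M + q"

definition W1 :: "market \<Rightarrow> real \<Rightarrow> real \<Rightarrow> real \<Rightarrow> real" where
  "W1 M q p p' =
     max (dbar M - alpha M * (1 - eps M) * p + eps M * alpha M * p') 0 * (p - CMq M q) - OM M"

definition W2 :: "market \<Rightarrow> real \<Rightarrow> real \<Rightarrow> real" where
  "W2 M q p = max (dbar M - alpha M * p) 0 * (p - CMq M q) - OM M"

definition W3 :: "market \<Rightarrow> real \<Rightarrow> real \<Rightarrow> real" where
  "W3 M q p = max (dbar M - alpha M * (1 - eps M) * p) 0 * (p - CMq M q) - OM M"

definition W4 :: "market \<Rightarrow> real \<Rightarrow> real \<Rightarrow> real" where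
  "W4 M q p =
     max (dbar M * (1 + eps M) - alpha M * (1 - eps M) * p) 0 * (p - CMq M q) - OM M"

definition price_grid :: "real \<Rightarrow> real set" where
  "price_grid \<delta> = range (\<lambda>k::nat. real k * \<delta>)"

datatype strategy = Price real | No_Operation

definition strategies :: "real \<Rightarrow> strategy set" where
  "strategies \<delta> = Price ` price_grid \<delta> \<union> {No_Operation}"

text \<open>The first strategy argument is the player's own strategy, the second one the opponent's.\<close>

fun utility :: "market \<Rightarrow> real \<Rightarrow> strategy \<Rightarrow> strategy \<Rightarrow> real" where
  "utility M q No_Operation s = 0"
| "utility M q (Price p) No_Operation = W4 M q p"
| "utility M q (Price p) (Price p') =
     (if p < p' then W1 M q p p' else if p > p' then W2 M q p else W3 M q p)"

definition pure_nash_equilibrium :: "market \<Rightarrow> real \<Rightarrow> real \<Rightarrow> strategy \<times> strategy \<Rightarrow> bool" where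
  "pure_nash_equilibrium M q \<delta> = (\<lambda>(s\<^sub>i, s\<^sub>j).
     s\<^sub>i \<in> strategies \<delta> \<and> s\<^sub>j \<in> strategies \<delta> \<and>
     (\<forall>s \<in> strategies \<delta>. utility M q s s\<^sub>j \<le> utility M q s\<^sub>i s\<^sub>j) \<and>
     (\<forall>s \<in> strategies \<delta>. utility M q s s\<^sub>i \<le> utility M q s\<^sub>j s\<^sub>i))"

text \<open>The price grid is infinite, but demand vanishes for all large prices, so only finitely many
  values are taken (lemmas \<open>finite_W2_image\<close> and \<open>finite_W4_image\<close>) and \<^const>\<open>Max\<close> is
  the true maximum.\<close>

definition W2_max :: "market \<Rightarrow> real \<Rightarrow> real \<Rightarrow> real" where
  "W2_max M \<delta> q = Max (W2 M q ` price_grid \<delta>)"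

definition W4_max :: "market \<Rightarrow> real \<Rightarrow> real \<Rightarrow> real" where
  "W4_max M \<delta> q = Max (W4 M q ` price_grid \<delta>)"

lemma finite_demand_image:
  fixes a b c r \<delta> :: real
  assumes "b > 0" "\<delta> > 0"
  shows "finite ((\<lambda>p. max (a - b * p) 0 * (p - c) - r) ` price_grid \<delta>)"
proof -
  let ?f = "\<lambda>p. max (a - b * p) 0 * (p - c) - r"
  obtain N :: nat where N: "a / (b * \<delta>) \<le> real N"
    using real_arch_simple by blast
  have "?f (real k * \<delta>) = - r" if "k \<ge> N" for k
  proof -
    have "a / (b * \<delta>) \<le> real k"
      using N that by linarith
    then have "a \<le> b * (real k * \<delta>)"
      using assms by (simp add: pos_divide_le_eq mult_ac)
    then show ?thesis
      by simp
  qed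
  then have "?f ` price_grid \<delta> \<subseteq> (\<lambda>k. ?f (real k * \<delta>)) ` {..<N} \<union> {- r}"
    unfolding price_grid_def image_image
    by (metis (mono_tags, lifting) UnCI image_eqI image_subsetI insertI1 lessThan_iff not_less)
  then show ?thesis
    by (rule finite_subset) simp
qed

lemma finite_W2_image:
  assumes "alpha M > 0" "\<delta> > 0"
  shows "finite (W2 M q ` price_grid \<delta>)"
  using finite_demand_image[OF assms] by (simp add: W2_def)

lemma finite_W4_image:
  assumes "alpha M > 0" "eps M < 1" "\<delta> > 0"
  shows "finite (W4 M q ` price_grid \<delta>)"
  using finite_demand_image[of "alpha M * (1 - eps M)" \<delta>] assms by (simp add: W4_def)

definition S_cc :: "market \<Rightarrow> real \<Rightarrow> real set" where
  "S_cc M \<delta> = {q. W4_max M \<delta> q < 0}"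

definition S_dp :: "market \<Rightarrow> real \<Rightarrow> real set" where
  "S_dp M \<delta> = {q. W2_max M \<delta> q \<ge> 0}"

definition S_pc :: "market \<Rightarrow> real \<Rightarrow> real set" where
  "S_pc M \<delta> = {q. W2_max M \<delta> q < 0}"

definition lambda_s :: "market \<Rightarrow> real \<Rightarrow> real" where
  "lambda_s M q = dbar M + alpha M * (1 - eps M) * CMq M q"

definition lambda_s_lower :: "market \<Rightarrow> real \<Rightarrow> real" where
  "lambda_s_lower M q = dbar M - alpha M * (1 - eps M) * CMq M q"

definition rho_s :: "market \<Rightarrow> real \<Rightarrow> real \<Rightarrow> real" where
  "rho_s M \<delta> q = - dbar M * CMq M q - max (W2_max M \<delta> q) 0 - OM M"

definition lambda_e :: "market \<Rightarrow> real \<Rightarrow> real \<Rightarrow> real" where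
  "lambda_e M \<delta> q = alpha M * eps M * CMq M q + alpha M * \<delta> * (3 * eps M - 2)"

definition rho_e :: "market \<Rightarrow> real \<Rightarrow> real \<Rightarrow> real" where
  "rho_e M \<delta> q = \<delta> * alpha M * (1 - eps M) * (CMq M q + \<delta>) + dbar M * \<delta>"

definition s_delta :: "market \<Rightarrow> real \<Rightarrow> real \<Rightarrow> real" where
  "s_delta M \<delta> q =
     (lambda_s M q - sqrt ((lambda_s M q)\<^sup>2 + 4 * alpha M * (1 - eps M) * rho_s M \<delta> q))
       / (2 * alpha M * (1 - eps M))"

definition e_tilde :: "market \<Rightarrow> real \<Rightarrow> real \<Rightarrow> real" where
  "e_tilde M \<delta> q = min
     ((lambda_e M \<delta> q + sqrt ((lambda_e M \<delta> q)\<^sup>2 + 4 * alpha M * eps M * rho_e M \<delta> q))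
       / (2 * alpha M * eps M))
     ((lambda_s M q + sqrt ((lambda_s_lower M q)\<^sup>2 - 4 * alpha M * (1 - eps M) * OM M))
       / (2 * alpha M * (1 - eps M)))"

text \<open>The two regimes are complementary (lemma \<open>S_pc_eq\<close>), so the second branch is
  \<open>q \<in> S_pc M \<delta>\<close>.\<close>

definition e_delta :: "market \<Rightarrow> real \<Rightarrow> real \<Rightarrow> real" where
  "e_delta M \<delta> q =
     (if q \<in> S_dp M \<delta> then min
        ((lambda_s M q + sqrt ((lambda_s M q)\<^sup>2 + 4 * alpha M * (1 - eps M) * rho_s M \<delta> q))
          / (2 * alpha M * (1 - eps M)))
        (e_tilde M \<delta> q)
      else e_tilde M \<delta> q)"

lemma S_pc_eq: "S_pc M \<delta> = - S_dp M \<delta>"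
  by (auto simp: S_pc_def S_dp_def)

definition q_bar_s :: "market \<Rightarrow> real" where
  "q_bar_s M =
     (dbar M - alpha M * (1 - eps M) * CM M - 2 * sqrt (alpha M * (1 - eps M) * OM M))
       / (alpha M * (1 - eps M))"

end

(* The endpoints s and e are roots of quadratics.  Being between them says that W3(x) dominates both 0 and
   every W2-value, and that undercutting the common price x by a single grid step is unprofitable.
   Undercutting by more is then unprofitable too: W1(., x) is concave in the player's own price, and
   W1(x - \<delta>, x) \<le> W3(x) \<le> W1(x, x) forces it to be nondecreasing up to x - \<delta>. *)

theory Submission
  imports Defs
begin

text \<open>Completing the square: \<open>4 * K\<close> times the quadratic is
  \<open>(2 * K * x - L)\<^sup>2\<close> minus the discriminant, and the two bounds say
  \<open>\<bar>2 * K * x - L\<bar> \<le> sqrt ?D\<close>.\<close>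

lemma quadratic_nonpos_between_roots:
  fixes K L R x :: real
  assumes "K > 0"
    and lower: "(L - sqrt (L\<^sup>2 + 4 * K * R)) / (2 * K) \<le> x"
    and upper: "x \<le> (L + sqrt (L\<^sup>2 + 4 * K * R)) / (2 * K)"
  shows "K * x\<^sup>2 - L * x - R \<le> 0"
proof -
  let ?D = "L\<^sup>2 + 4 * K * R"
  have "\<bar>2 * K * x - L\<bar> \<le> sqrt ?D"
    using lower upper \<open>K > 0\<close> by (simp add: field_simps abs_le_iff)
  \<comment> \<open>The root of a negative number is negative, so the discriminant is nonnegative here.\<close>
  moreover from this have "?D \<ge> 0"
    using real_sqrt_ge_0_iff by (meson abs_ge_zero order_trans)
  ultimately have "(2 * K * x - L)\<^sup>2 \<le> ?D"
    by (metis abs_ge_zero power2_abs power_mono real_sqrt_pow2)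
  then have "4 * K * (K * x\<^sup>2 - L * x - R) \<le> 0"
    by (simp add: power2_eq_square algebra_simps)
  with \<open>K > 0\<close> show ?thesis
    by (simp add: mult_le_0_iff)
qed

text \<open>The roots have product \<open>- R / K \<le> 0\<close>, so the smaller one is at most 0
  and \<open>x \<ge> 0\<close> supplies the lower bound.\<close>

lemma quadratic_nonpos_below_larger_root:
  fixes K L R x :: real
  assumes "K > 0" "R \<ge> 0" "x \<ge> 0"
    and upper: "x \<le> (L + sqrt (L\<^sup>2 + 4 * K * R)) / (2 * K)"
  shows "K * x\<^sup>2 - L * x - R \<le> 0"
proof (rule quadratic_nonpos_between_roots[OF \<open>K > 0\<close> _ upper])
  have "L \<le> sqrt (L\<^sup>2 + 4 * K * R)"
    using assms by (intro real_le_rsqrt) simp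
  with assms show "(L - sqrt (L\<^sup>2 + 4 * K * R)) / (2 * K) \<le> x"
    by (smt (verit) divide_nonpos_pos)
qed

text \<open>Nonpositivity of the quadratic with coefficients \<open>lambda_s\<close> and
  \<open>rho_s\<close> rearranges to the profit bound. The last two conclusions make the truncation
  in \<open>W3\<close> inactive.\<close>

lemma W3_ge_W2_max:
  assumes "alpha M > 0" "eps M < 1"
    and demand: "alpha M * (1 - eps M) * CMq M q < dbar M" and "OM M > 0"
    and s: "s_delta M \<delta> q \<le> x" and e: "x \<le> e_delta M \<delta> q"
  shows "max (W2_max M \<delta> q) 0 \<le> W3 M q x"
    and "CMq M q < x"
    and "alpha M * (1 - eps M) * x < dbar M"
proof -
  define b where "b = alpha M * (1 - eps M)"
  have "b > 0"
    using assms by (simp add: b_def)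
  let ?L = "lambda_s M q" and ?R = "rho_s M \<delta> q" and ?c = "CMq M q"
  have lower: "(?L - sqrt (?L\<^sup>2 + 4 * b * ?R)) / (2 * b) \<le> x"
    using s by (simp add: s_delta_def b_def mult.assoc)
  have upper: "x \<le> (?L + sqrt (?L\<^sup>2 + 4 * b * ?R)) / (2 * b)"
  proof (cases "q \<in> S_dp M \<delta>")
    case True
    then show ?thesis
      using e by (simp add: e_delta_def b_def mult.assoc)
  next
    case False
    then have "?R = - dbar M * ?c - OM M"
      by (simp add: S_dp_def rho_s_def)
    \<comment> \<open>With the positive part gone, the larger root is exactly the second entry of
      the minimum in \<open>e_tilde\<close>.\<close>
    then have "?L\<^sup>2 + 4 * b * ?R = (lambda_s_lower M q)\<^sup>2 - 4 * b * OM M"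
      by (simp add: lambda_s_def lambda_s_lower_def flip: b_def)
        (simp add: power2_eq_square algebra_simps)
    then show ?thesis
      using e False by (simp add: e_delta_def e_tilde_def b_def mult.assoc)
  qed
  have "b * x\<^sup>2 - ?L * x - ?R \<le> 0"
    using quadratic_nonpos_between_roots[OF \<open>b > 0\<close> lower upper] .
  then have profit: "max (W2_max M \<delta> q) 0 + OM M \<le> (dbar M - b * x) * (x - ?c)"
    by (simp add: lambda_s_def rho_s_def flip: b_def)
      (simp add: power2_eq_square algebra_simps)
  then have pos: "0 < (dbar M - b * x) * (x - ?c)"
    using \<open>OM M > 0\<close> by linarith
  \<comment> \<open>The two factors have equal sign; both being negative would put \<open>x\<close>
    above \<open>dbar M / b\<close> yet below \<open>?c\<close>, against
    \<open>demand\<close>.\<close>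
  have "\<not> x < ?c"
  proof
    assume "x < ?c"
    with pos have "dbar M < b * x"
      by (simp add: zero_less_mult_iff)
    also have "\<dots> < b * ?c"
      using \<open>x < ?c\<close> \<open>b > 0\<close> by simp
    finally show False
      using demand by (simp add: b_def)
  qed
  with pos show "?c < x" and "alpha M * (1 - eps M) * x < dbar M"
    by (auto simp: zero_less_mult_iff b_def)
  then have "W3 M q x = (dbar M - b * x) * (x - ?c) - OM M"
    by (simp add: W3_def b_def)
  with profit show "max (W2_max M \<delta> q) 0 \<le> W3 M q x"
    by linarith
qed

text \<open>For an undercut by \<open>u = x - p\<close>, with truncations inactive,
  \<open>W3 M q x - W1 M q p x\<close> equals \<open>u * ?h u - a * x * (x - ?c)\<close>. Here
  \<open>?h\<close> is affine and increasing, so the bound at \<open>u = \<delta>\<close> extends to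
  all larger \<open>u\<close>.\<close>

lemma W1_undercut_le_W3:
  assumes "alpha M > 0" "0 < eps M" "eps M < 1" "dbar M \<ge> 0" "CMq M q \<ge> 0" "\<delta> > 0" "x \<ge> 0"
    and c: "CMq M q \<le> x" and dem: "alpha M * (1 - eps M) * x \<le> dbar M"
    and e: "x \<le> e_tilde M \<delta> q"
    and p: "p \<le> x - \<delta>"
  shows "W1 M q p x \<le> W3 M q x"
proof -
  define b where "b = alpha M * (1 - eps M)"
  define a where "a = eps M * alpha M"
  have "b > 0" "a > 0"
    using assms by (auto simp: a_def b_def)
  let ?d = "dbar M" and ?c = "CMq M q"
  let ?h = "\<lambda>t. ?d + a * x - 2 * b * x + b * ?c + b * t"
  have step: "a * x\<^sup>2 - lambda_e M \<delta> q * x - rho_e M \<delta> q \<le> 0"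
    using \<open>a > 0\<close> \<open>x \<ge> 0\<close> e assms(1-6)
    by (intro quadratic_nonpos_below_larger_root) (auto simp: e_tilde_def rho_e_def a_def mult_ac)
  have lambda: "lambda_e M \<delta> q = a * ?c + a * \<delta> - 2 * b * \<delta>"
    by (simp add: lambda_e_def a_def b_def algebra_simps)
  have rho: "rho_e M \<delta> q = b * \<delta> * (?c + \<delta>) + ?d * \<delta>"
    by (simp add: rho_e_def b_def)
  \<comment> \<open>The quadratic behind the first entry of \<open>e_tilde\<close> is precisely the
    case \<open>u = \<delta>\<close>.\<close>
  have gain: "a * x * (x - ?c) \<le> \<delta> * ?h \<delta>"
    using step unfolding lambda rho by (simp add: power2_eq_square algebra_simps)
  moreover have "0 \<le> a * x * (x - ?c)"
    using \<open>a > 0\<close> \<open>x \<ge> 0\<close> c by simp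
  \<comment> \<open>This sign is what lets both factors of \<open>u * ?h u\<close> grow
    together.\<close>
  ultimately have h0: "0 \<le> ?h \<delta>"
    using \<open>\<delta> > 0\<close> by (smt (verit) mult_pos_neg)
  have "?h \<delta> \<le> ?h (x - p)"
    using p \<open>b > 0\<close> by simp
  then have "\<delta> * ?h \<delta> \<le> (x - p) * ?h (x - p)"
    using p \<open>\<delta> > 0\<close> h0 by (intro mult_mono) auto
  with gain have "a * x * (x - ?c) \<le> (x - p) * ?h (x - p)"
    by linarith
  then have "(?d - b * p + a * x) * (p - ?c) \<le> (?d - b * x) * (x - ?c)"
    by (simp add: algebra_simps)
  moreover have "0 \<le> ?d - b * p + a * x"
  proof -
    have "b * p \<le> b * x"
      using p \<open>\<delta> > 0\<close> \<open>b > 0\<close> by simp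
    then show ?thesis
      using dem \<open>a > 0\<close> \<open>x \<ge> 0\<close> by (simp add: b_def add_increasing2)
  qed
  ultimately show ?thesis
    using dem by (simp add: W1_def W3_def a_def b_def)
qed

lemma W2_le_W2_max:
  assumes "alpha M > 0" "\<delta> > 0" "p \<in> price_grid \<delta>"
  shows "W2 M q p \<le> W2_max M \<delta> q"
  unfolding W2_max_def using assms by (intro Max_ge finite_W2_image) auto

lemma price_grid_less_imp_le_diff:
  assumes "\<delta> > 0" "p \<in> price_grid \<delta>" "x \<in> price_grid \<delta>" "p < x"
  shows "p \<le> x - \<delta>"
proof -
  obtain k l :: nat where kl: "p = real k * \<delta>" "x = real l * \<delta>"
    using assms by (auto simp: price_grid_def)
  with assms have "real (Suc k) \<le> real l"
    by simp
  then have "real (Suc k) * \<delta> \<le> real l * \<delta>"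
    using \<open>\<delta> > 0\<close> by (intro mult_right_mono) auto
  then show ?thesis
    by (simp add: kl algebra_simps)
qed

theorem theorem1:
  fixes M :: market and \<delta> q :: real and l :: nat
  assumes "dbar M > 0" and "alpha M > 0" and "0 < eps M" and "eps M < 1"
    and "CM M \<ge> 0" and "OM M > 0" and "CS M \<ge> 0"
    and "dbar M > alpha M * (CS M + CM M) + 2 * sqrt (alpha M * OM M)"
    and "\<delta> > 0" and "q \<ge> 0"
    and "q \<notin> S_cc M \<delta>" and "q \<le> q_bar_s M"
    and "s_delta M \<delta> q \<le> e_delta M \<delta> q"
    and "l > 0"
    and "real l * \<delta> \<in> {s_delta M \<delta> q .. e_delta M \<delta> q}"
  shows "pure_nash_equilibrium M q \<delta> (Price (real l * \<delta>), Price (real l * \<delta>))"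
proof -
  define x where "x = real l * \<delta>"
  have "x \<ge> 0" and x: "x \<in> price_grid \<delta>"
    using \<open>\<delta> > 0\<close> by (auto simp: x_def price_grid_def)
  have s: "s_delta M \<delta> q \<le> x" and e: "x \<le> e_delta M \<delta> q"
    using assms(15) by (auto simp: x_def)
  have "x \<le> e_tilde M \<delta> q"
    using e by (auto simp: e_delta_def split: if_splits)
  have "alpha M * (1 - eps M) > 0"
    using assms by simp
  \<comment> \<open>This is \<open>q \<le> q_bar_s M\<close> with the denominator cleared; the
    positive root then makes the demand bound strict.\<close>
  then have "alpha M * (1 - eps M) * CMq M q + 2 * sqrt (alpha M * (1 - eps M) * OM M) \<le> dbar M"
    using assms(12) by (simp add: q_bar_s_def CMq_def pos_le_divide_eq algebra_simps)
  moreover have "sqrt (alpha M * (1 - eps M) * OM M) > 0"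
    using assms by simp
  ultimately have "alpha M * (1 - eps M) * CMq M q < dbar M"
    by linarith
  note W3 = W3_ge_W2_max[OF assms(2,4) this assms(6) s e]
  \<comment> \<open>Both players use the same strategy, so this one deviation bound settles both
    equilibrium conditions.\<close>
  have "utility M q t (Price x) \<le> utility M q (Price x) (Price x)" if t: "t \<in> strategies \<delta>" for t
  proof (cases t)
    case No_Operation
    then show ?thesis
      using W3(1) by simp
  next
    case (Price p)
    then have p: "p \<in> price_grid \<delta>"
      using t by (auto simp: strategies_def)
    have "W1 M q p x \<le> W3 M q x" if "p < x"
      using assms W3 \<open>x \<ge> 0\<close> \<open>x \<le> e_tilde M \<delta> q\<close> price_grid_less_imp_le_diff[OF \<open>\<delta> > 0\<close> p x that]
      by (intro W1_undercut_le_W3[where \<delta> = \<delta>]) (auto simp: CMq_def)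
    moreover have "W2 M q p \<le> W3 M q x"
      using W2_le_W2_max[OF assms(2,9) p, of q] W3(1) by simp
    ultimately show ?thesis
      using Price by simp
  qed
  moreover have "Price x \<in> strategies \<delta>"
    using x by (simp add: strategies_def)
  ultimately show ?thesis
    by (simp add: pure_nash_equilibrium_def flip: x_def)
qed

end
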